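(* Let $n$ be a positive integer and let $G$ be an oriented graph with at most $n^2 \log n$ edges. Then the edges of $G$ can be coloured with $2$ colours such that every monochromatic directed path in $G$ has length at most $169\, n$.
   Context: Graphs are finite. An oriented graph is a directed graph without loops such that for every two vertices $x, y$ at most one of $xy$ and $yx$ is an edge. A directed path is a sequence of distinct vertices $v_0, v_1, \ldots, v_\ell$ such that $v_{i-1}v_i$ is an edge for each $1 \le i \le \ell$; its length is its number of edges $\ell$. It is monochromatic if all its edges have the same colour. All logarithms are in base $2$. *)

theory Defs
  imports Complex_Main "Graph_Theory.Arc_Walk"
begin

(* The library's digraph locale already gives: finite, no loops, no parallel arcs. *)
locale oriented_graph = digraph +
  assumes no_opposite_arcs: "u \<rightarrow>\<^bsub>G\<^esub> v \<Longrightarrow> \<not> v \<rightarrow>\<^bsub>G\<^esub> u"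

definition two_colouring :: "('a, 'b) pre_digraph \<Rightarrow> ('b \<Rightarrow> nat) \<Rightarrow> bool" where
  "two_colouring G c \<longleftrightarrow> (\<forall>e \<in> arcs G. c e \<in> {1, 2})"

(* A directed path from u to v (pre_digraph.apath G u p v) is represented by its list of arcs p,
   so its length in edges is length p. *)
definition monochromatic :: "('b \<Rightarrow> nat) \<Rightarrow> 'b awalk \<Rightarrow> bool" where
  "monochromatic c p \<longleftrightarrow> (\<exists>i. \<forall>e \<in> set p. c e = i)"

end

theory Submission
  imports Defs
begin

text \<open>
  If vertex functions \<open>f\<close>, \<open>g\<close> with values below \<open>K\<close> are such that every arc increases \<open>f\<close> or \<open>g\<close>,
  then colouring an arc by whether it increases \<open>f\<close> bounds monochromatic paths by \<open>K\<close>. The least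
  such \<open>K\<close> is subadditive under unions of vertex sets, it is at most \<open>d\<close> when all degrees are below
  \<open>d\<close>, and it is about the square root of \<open>k\<close> for an acyclic set with \<open>k\<close> layers. So it is enough
  to split the vertices of degree at least \<open>n\<close> into large acyclic sets with few layers.

  Put \<open>L = log n\<close>. Every \<open>n\<close> vertices contain an acyclic set of size \<open>L\<close> (Erdos and
  Moser), so \<open>O(n sqrt L)\<close> vertices can be split at cost \<open>O(n)\<close>. A larger set of \<open>N\<close> vertices has edge
  density \<open>1/s\<close> with \<open>s\<close> of order \<open>N^2 / (n^2 L)\<close>, and there the argument of Erdos and Szemeredi gives
  an acyclic set of size of order \<open>s L / log s\<close> with only \<open>L/2\<close> layers: one keeps a union of about
  \<open>s / log s\<close> pairwise non-adjacent transitive pieces, choosing each new piece among vertices that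
  all have the same, small, neighbourhood in the earlier pieces and deleting that neighbourhood.
  Removing such sets while \<open>N\<close> shrinks from \<open>2^(e+1) n sqrt L\<close> to \<open>2^e n sqrt L\<close> costs
  \<open>O((e+1) n / 2^e)\<close>, which is summable in \<open>e\<close>.
\<close>

section \<open>Vertex orders and layerings, and how they combine\<close>

definition biorderable :: "('a \<times> 'a) set \<Rightarrow> 'a set \<Rightarrow> nat \<Rightarrow> bool" where
  "biorderable R S K \<longleftrightarrow> (\<exists>f g :: 'a \<Rightarrow> nat. (\<forall>v\<in>S. f v < K \<and> g v < K) \<and>
     (\<forall>u\<in>S. \<forall>v\<in>S. (u, v) \<in> R \<longrightarrow> f u < f v \<or> g u < g v))"

text \<open>The number \<open>k\<close> of layers is kept apart from the size of \<open>S\<close>: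
  the cost depends on \<open>k\<close> only, and merging non-adjacent pieces enlarges the set while
  \<open>k\<close> stays fixed.\<close>

definition layered :: "('a \<times> 'a) set \<Rightarrow> 'a set \<Rightarrow> nat \<Rightarrow> bool" where
  "layered R S k \<longleftrightarrow> (\<exists>h :: 'a \<Rightarrow> nat. (\<forall>v\<in>S. h v < k) \<and>
     (\<forall>u\<in>S. \<forall>v\<in>S. (u, v) \<in> R \<longrightarrow> h u < h v))"

definition nbrs :: "('a \<times> 'a) set \<Rightarrow> 'a \<Rightarrow> 'a set" where
  "nbrs R v = {u. (u, v) \<in> R \<or> (v, u) \<in> R}"

lemma finite_nbrs:
  assumes "finite R"
  shows "finite (nbrs R v)"
proof (rule finite_subset)
  show "nbrs R v \<subseteq> fst ` R \<union> snd ` R" unfolding nbrs_def by force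
qed (use assms in auto)

lemma biorderable_mono:
  assumes "biorderable R S K" "S' \<subseteq> S" "K \<le> K'"
  shows "biorderable R S' K'"
proof -
  obtain f g where "\<forall>v\<in>S. f v < K \<and> g v < K"
      "\<forall>u\<in>S. \<forall>v\<in>S. (u, v) \<in> R \<longrightarrow> f u < f v \<or> g u < (g v :: nat)"
    using assms(1) unfolding biorderable_def by blast
  moreover have "f v < K' \<and> g v < K'" if "f v < K \<and> g v < K" for v
    using that assms(3) by linarith
  ultimately show ?thesis using assms(2) unfolding biorderable_def
    by (intro exI[of _ f] exI[of _ g]) (simp add: subset_iff)
qed

lemma layered_mono: "layered R S k \<Longrightarrow> S' \<subseteq> S \<Longrightarrow> layered R S' k"
  unfolding layered_def by (meson subsetD)

text \<open>In the first order all of \<open>S\<close> is placed below the rest of \<open>T\<close>,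
  in the second above it. So an arc leaving \<open>S\<close> raises the first function and an arc
  entering \<open>S\<close> raises the second; common vertices count as members of
  \<open>S\<close>.\<close>

lemma biorderable_Un:
  assumes "biorderable R S K" "biorderable R T K'"
  shows "biorderable R (S \<union> T) (K + K')"
proof -
  obtain f g where fg: "\<And>v. v \<in> S \<Longrightarrow> f v < K \<and> g v < K"
      "\<And>u v. u \<in> S \<Longrightarrow> v \<in> S \<Longrightarrow> (u, v) \<in> R \<Longrightarrow> f u < f v \<or> g u < g v"
    using assms(1) unfolding biorderable_def by metis
  obtain f' g' where fg': "\<And>v. v \<in> T \<Longrightarrow> f' v < K' \<and> g' v < K'"
      "\<And>u v. u \<in> T \<Longrightarrow> v \<in> T \<Longrightarrow> (u, v) \<in> R \<Longrightarrow> f' u < f' v \<or> g' u < g' v"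
    using assms(2) unfolding biorderable_def by metis
  define F where "F v = (if v \<in> S then f v else K + f' v)" for v
  define H where "H v = (if v \<in> S then K' + g v else g' v)" for v
  have "F v < K + K' \<and> H v < K + K'" if "v \<in> S \<union> T" for v
    using that fg(1)[of v] fg'(1)[of v] by (auto simp: F_def H_def)
  moreover have "F u < F v \<or> H u < H v" if "u \<in> S \<union> T" "v \<in> S \<union> T" "(u, v) \<in> R" for u v
    using that fg(1)[of u] fg(1)[of v] fg'(1)[of u] fg'(1)[of v] fg(2)[of u v] fg'(2)[of u v]
    by (cases "u \<in> S"; cases "v \<in> S") (auto simp: F_def H_def)
  ultimately show ?thesis unfolding biorderable_def by blast
qed

text \<open>A layer number has two digits in base \<open>r\<close>. When it rises, either the
  leading digit rises, or that digit is unchanged and the last one rises.\<close>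

lemma layered_imp_biorderable:
  assumes "layered R S k" "k \<le> r * r"
  shows "biorderable R S r"
proof -
  obtain h where h: "\<And>v. v \<in> S \<Longrightarrow> h v < k"
      "\<And>u v. u \<in> S \<Longrightarrow> v \<in> S \<Longrightarrow> (u, v) \<in> R \<Longrightarrow> h u < h v"
    using assms(1) unfolding layered_def by metis
  have "h v div r < r \<and> h v mod r < r" if "v \<in> S" for v
  proof -
    have "h v < r * r" using h(1)[OF that] assms(2) by linarith
    moreover from this have "0 < r" by (cases r) auto
    ultimately show ?thesis by (simp add: less_mult_imp_div_less)
  qed
  moreover have "h u div r < h v div r \<or> h u mod r < h v mod r"
    if "u \<in> S" "v \<in> S" "(u, v) \<in> R" for u v
  proof -
    have lt: "h u < h v" using h(2) that by blast
    then have "h u div r \<le> h v div r" by (simp add: div_le_mono)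
    moreover have "h u mod r < h v mod r" if "h u div r = h v div r"
    proof -
      have "r * (h v div r) + h u mod r = h u" using mult_div_mod_eq[of r "h u"] that by simp
      then have "r * (h v div r) + h u mod r < r * (h v div r) + h v mod r"
        using lt mult_div_mod_eq[of r "h v"] by (simp del: mult_div_mod_eq)
      then show ?thesis by (rule add_less_imp_less_left)
    qed
    ultimately show ?thesis by linarith
  qed
  ultimately show ?thesis unfolding biorderable_def
    by (intro exI[of _ "\<lambda>v. h v div r"] exI[of _ "\<lambda>v. h v mod r"] conjI ballI impI) simp_all
qed

text \<open>Without arcs across, both layerings can use the same \<open>k\<close> layers, so the
  numbers of layers do not add up.\<close>

lemma layered_Un_no_arcs:
  assumes "layered R S k" "layered R T k" "S \<inter> T = {}"
    and "\<And>u v. u \<in> S \<Longrightarrow> v \<in> T \<Longrightarrow> u \<notin> nbrs R v"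
  shows "layered R (S \<union> T) k"
proof -
  obtain f where f: "\<And>v. v \<in> S \<Longrightarrow> f v < k"
      "\<And>u v. u \<in> S \<Longrightarrow> v \<in> S \<Longrightarrow> (u, v) \<in> R \<Longrightarrow> f u < f v"
    using assms(1) unfolding layered_def by metis
  obtain g where g: "\<And>v. v \<in> T \<Longrightarrow> g v < k"
      "\<And>u v. u \<in> T \<Longrightarrow> v \<in> T \<Longrightarrow> (u, v) \<in> R \<Longrightarrow> g u < g v"
    using assms(2) unfolding layered_def by metis
  define h where "h v = (if v \<in> S then f v else g v)" for v
  have "\<forall>v\<in>S \<union> T. h v < k" using f(1) g(1) by (auto simp: h_def)
  moreover have "h u < h v" if "u \<in> S \<union> T" "v \<in> S \<union> T" "(u, v) \<in> R" for u v
    using that assms(4)[of u v] assms(4)[of v u] f(2)[of u v] g(2)[of u v] assms(3)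
    by (cases "u \<in> S"; cases "v \<in> S") (auto simp: h_def nbrs_def)
  ultimately show ?thesis unfolding layered_def by blast
qed

lemma biorderable_card:
  assumes "finite S" "asym R"
  shows "biorderable R S (card S)"
  using assms(1)
proof (induction S)
  case empty
  then show ?case by (simp add: biorderable_def)
next
  case (insert x S)
  have "biorderable R {x} 1"
    using asymD[OF assms(2)] unfolding biorderable_def by fastforce
  from biorderable_Un[OF insert.IH this] insert.hyps show ?case by simp
qed

text \<open>Greedy proper colouring: a new vertex sees fewer than \<open>K\<close> colours on its
  neighbours. Taking the colours upwards for one order and downwards for the other, each arc
  increases one of them because its ends differ in colour.\<close>

lemma biorderable_low_degree:
  assumes "finite S" "asym R" "finite R"
    and "\<And>v. v \<in> S \<Longrightarrow> card (nbrs R v) < K"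
  shows "biorderable R S K"
proof -
  note fin = finite_nbrs[OF assms(3)]
  have "\<exists>c :: 'a \<Rightarrow> nat. (\<forall>v\<in>S. c v < K) \<and> (\<forall>u\<in>S. \<forall>v\<in>S. (u, v) \<in> R \<longrightarrow> c u \<noteq> c v)"
    using assms(1,4)
  proof (induction S)
    case (insert x S)
    then obtain c where c: "\<And>v. v \<in> S \<Longrightarrow> c v < K"
        "\<And>u v. u \<in> S \<Longrightarrow> v \<in> S \<Longrightarrow> (u, v) \<in> R \<Longrightarrow> c u \<noteq> c v"
      by (metis insertI2)
    have "card (c ` nbrs R x) < card {..<K}"
      using card_image_le[OF fin[of x], of c] insert.prems[of x] by simp
    then have "\<not> {..<K} \<subseteq> c ` nbrs R x"
      using card_mono[of "c ` nbrs R x" "{..<K}"] fin[of x] by fastforce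
    then obtain i where i: "i < K" "i \<notin> c ` nbrs R x" by auto
    have "\<forall>u\<in>insert x S. \<forall>v\<in>insert x S. (u, v) \<in> R \<longrightarrow> (c(x := i)) u \<noteq> (c(x := i)) v"
      using c(2) i(2) asymD[OF assms(2), of x x] by (auto simp: nbrs_def)
    moreover have "\<forall>v\<in>insert x S. (c(x := i)) v < K" using c(1) i(1) by auto
    ultimately show ?case by blast
  qed auto
  then obtain c where c: "\<forall>v\<in>S. c v < K"
      "\<forall>u\<in>S. \<forall>v\<in>S. (u, v) \<in> R \<longrightarrow> c u \<noteq> c v" by blast
  have "c u < c v \<or> K - 1 - c u < K - 1 - c v" if "u \<in> S" "v \<in> S" "(u, v) \<in> R" for u v
  proof -
    have "c u < K" "c v < K" "c u \<noteq> c v" using c that by blast+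
    then show ?thesis by linarith
  qed
  moreover have "\<forall>v\<in>S. c v < K \<and> K - 1 - c v < K" using c(1) by fastforce
  ultimately show ?thesis unfolding biorderable_def
    by (intro exI[of _ c] exI[of _ "\<lambda>v. K - 1 - c v"]) blast
qed

section \<open>Large acyclic sets and their repeated extraction\<close>

text \<open>A vertex \<open>v\<close> splits the others into its in-neighbours \<open>P\<close> and
  the rest \<open>Q\<close>, one of which has at least \<open>2 ^ k\<close> vertices. By asymmetry
  \<open>v\<close> can become a new top layer over a set found in \<open>P\<close>; arcs between
  \<open>v\<close> and \<open>Q\<close> all leave \<open>v\<close>, so there it becomes a new bottom
  layer.\<close>

lemma erdos_moser:
  assumes "asym R" "finite S" "2 ^ k \<le> card S"
  shows "\<exists>T\<subseteq>S. card T = k \<and> layered R T k"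
  using assms(2,3)
proof (induction k arbitrary: S)
  case 0
  then show ?case by (auto simp: layered_def intro!: exI[of _ "{}"])
next
  case (Suc k)
  have "card S > 0" using Suc.prems(2) by (metis less_le_trans zero_less_numeral zero_less_power)
  then obtain v where v: "v \<in> S" by fastforce
  define P where "P = {u \<in> S - {v}. (u, v) \<in> R}"
  define Q where "Q = {u \<in> S - {v}. (u, v) \<notin> R}"
  have "card P + card Q = card S - 1"
  proof -
    have "card P + card Q = card (P \<union> Q)"
      by (rule card_Un_disjoint[symmetric]) (use Suc.prems(1) in \<open>auto simp: P_def Q_def\<close>)
    also have "P \<union> Q = S - {v}" by (auto simp: P_def Q_def)
    finally show ?thesis using v by simp
  qed
  then consider "2 ^ k \<le> card P" | "2 ^ k \<le> card Q"
    using Suc.prems(2) by fastforce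
  then show ?case
  proof cases
    case 1
    have "finite P" using Suc.prems(1) by (simp add: P_def)
    from Suc.IH[OF this 1] obtain T h where T: "T \<subseteq> P" "card T = k"
      and h: "\<And>x. x \<in> T \<Longrightarrow> h x < k"
        "\<And>x y. x \<in> T \<Longrightarrow> y \<in> T \<Longrightarrow> (x, y) \<in> R \<Longrightarrow> h x < (h y :: nat)"
      unfolding layered_def by metis
    have "v \<notin> T" "finite T" using T(1) \<open>finite P\<close> by (auto simp: P_def intro: finite_subset)
    then have "card (insert v T) = Suc k" using T(2) by simp
    moreover have "insert v T \<subseteq> S" using T(1) v by (auto simp: P_def)
    moreover have "layered R (insert v T) (Suc k)"
      unfolding layered_def
    proof (intro exI[of _ "h(v := k)"] conjI ballI impI)
      fix x y assume xy: "x \<in> insert v T" "y \<in> insert v T" "(x, y) \<in> R"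
      then have "x \<noteq> v"
        using T(1) asymD[OF assms(1)] by (auto simp: P_def)
      then show "(h(v := k)) x < (h(v := k)) y" using xy h by auto
    qed (use h in \<open>auto intro: less_SucI\<close>)
    ultimately show ?thesis by blast
  next
    case 2
    have "finite Q" using Suc.prems(1) by (simp add: Q_def)
    from Suc.IH[OF this 2] obtain T h where T: "T \<subseteq> Q" "card T = k"
      and h: "\<And>x. x \<in> T \<Longrightarrow> h x < k"
        "\<And>x y. x \<in> T \<Longrightarrow> y \<in> T \<Longrightarrow> (x, y) \<in> R \<Longrightarrow> h x < (h y :: nat)"
      unfolding layered_def by metis
    have "v \<notin> T" "finite T" using T(1) \<open>finite Q\<close> by (auto simp: Q_def intro: finite_subset)
    then have "card (insert v T) = Suc k" using T(2) by simp
    moreover have "insert v T \<subseteq> S" using T(1) v by (auto simp: Q_def)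
    moreover have "layered R (insert v T) (Suc k)"
      unfolding layered_def
    proof (intro exI[of _ "\<lambda>x. if x = v then 0 else Suc (h x)"] conjI ballI impI)
      fix x y assume xy: "x \<in> insert v T" "y \<in> insert v T" "(x, y) \<in> R"
      then have "y \<noteq> v"
        using T(1) asymD[OF assms(1)] by (auto simp: Q_def)
      then show "(if x = v then 0 else Suc (h x)) < (if y = v then 0 else Suc (h y))"
        using xy h by auto
    qed (use h in auto)
    ultimately show ?thesis by blast
  qed
qed

text \<open>Sets of at least \<open>q\<close> vertices are peeled off at cost \<open>r\<close> each,
  until at most \<open>M\<close> vertices are left and the flat cost \<open>K\<close> finishes. Each
  round removes \<open>q\<close> from the excess over \<open>M\<close>, so \<open>j\<close> rounds
  suffice.\<close>

lemma biorderable_extraction: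
  assumes "finite U"
    and large: "\<And>S. S \<subseteq> U \<Longrightarrow> M \<le> card S \<Longrightarrow> \<exists>A\<subseteq>S. q \<le> card A \<and> biorderable R A r"
    and small: "\<And>S. S \<subseteq> U \<Longrightarrow> card S \<le> M \<Longrightarrow> biorderable R S K"
    and "S \<subseteq> U" "card S \<le> M + q * j"
  shows "biorderable R S (K + r * j)"
  using assms(4,5)
proof (induction j arbitrary: S)
  case 0
  then show ?case using small by simp
next
  case (Suc j)
  show ?case
  proof (cases "card S \<le> M")
    case True
    then show ?thesis using small[OF Suc.prems(1)] biorderable_mono le_add1 by blast
  next
    case False
    then obtain A where A: "A \<subseteq> S" "q \<le> card A" "biorderable R A r"
      using large[OF Suc.prems(1)] by fastforce
    have "finite S" using Suc.prems(1) assms(1) finite_subset by blast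
    then have "card (S - A) = card S - card A"
      using A(1) card_Diff_subset finite_subset by blast
    then have "card (S - A) \<le> M + q * j" using A(2) Suc.prems(2) by simp
    then have "biorderable R (S - A) (K + r * j)" using Suc.IH Suc.prems(1) by blast
    then have "biorderable R ((S - A) \<union> A) (K + r * j + r)" using A(3) by (rule biorderable_Un)
    moreover have "(S - A) \<union> A = S" using A(1) by blast
    ultimately show ?thesis by (simp add: ac_simps)
  qed
qed

section \<open>Counting small subsets and accumulating non-adjacent pieces\<close>

lemma sum_power_card_Pow:
  fixes y :: "'b :: comm_semiring_1"
  assumes "finite T"
  shows "(\<Sum>X\<in>Pow T. y ^ card X) = (1 + y) ^ card T"
  using assms
proof (induction T)
  case (insert x T)
  have "(\<Sum>X\<in>insert x ` Pow T. y ^ card X) = (\<Sum>X\<in>Pow T. y ^ card (insert x X))"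
    by (rule sum.reindex_cong[of "insert x"]) (use insert.hyps in \<open>auto simp: inj_on_def\<close>)
  also have "\<dots> = (\<Sum>X\<in>Pow T. y * y ^ card X)"
  proof (rule sum.cong)
    fix X assume "X \<in> Pow T"
    then have "x \<notin> X" "finite X" using insert.hyps finite_subset by auto
    then show "y ^ card (insert x X) = y * y ^ card X" by simp
  qed simp
  finally have "(\<Sum>X\<in>insert x ` Pow T. y ^ card X) = y * (1 + y) ^ card T"
    using insert.IH by (simp flip: sum_distrib_left)
  moreover have "(\<Sum>X\<in>Pow (insert x T). y ^ card X)
      = (\<Sum>X\<in>Pow T. y ^ card X) + (\<Sum>X\<in>insert x ` Pow T. y ^ card X)"
    unfolding Pow_insert by (rule sum.union_disjoint) (use insert.hyps in auto)
  ultimately show ?case using insert by (simp add: distrib_right)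
qed simp

text \<open>Compare with the generating function of the subset sizes at \<open>y = 1/s\<close>, where \<open>(1 + y)^s \<le> 4\<close>.\<close>

lemma card_small_subsets:
  assumes "finite T" "card T \<le> s * t" "1 \<le> s"
  shows "card {X. X \<subseteq> T \<and> card X \<le> t} \<le> (4 * s) ^ t"
proof -
  let ?F = "{X. X \<subseteq> T \<and> card X \<le> t}"
  define y where "y = 1 / real s"
  have y: "0 < y" "y \<le> 1" using assms(3) by (auto simp: y_def)
  have "real (card ?F) * y ^ t = (\<Sum>X\<in>?F. y ^ t)" by simp
  also have "\<dots> \<le> (\<Sum>X\<in>?F. y ^ card X)"
    by (rule sum_mono) (use y in \<open>auto intro: power_decreasing\<close>)
  also have "\<dots> \<le> (\<Sum>X\<in>Pow T. y ^ card X)"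
    by (rule sum_mono2) (use y assms(1) in auto)
  also have "\<dots> = (1 + y) ^ card T" by (rule sum_power_card_Pow[OF assms(1)])
  also have "\<dots> \<le> (1 + y) ^ (s * t)"
    by (rule power_increasing) (use y assms(2) in auto)
  also have "\<dots> = ((1 + y) ^ s) ^ t" by (simp add: power_mult)
  also have "\<dots> \<le> 4 ^ t"
  proof (rule power_mono)
    have "(1 + y) ^ s \<le> exp y ^ s" using y by (intro power_mono) auto
    also have "\<dots> = exp (real s * y)" by (rule exp_of_nat_mult[symmetric])
    also have "real s * y = 1" using assms(3) by (simp add: y_def)
    also have "exp (1 :: real) \<le> 4" using exp_le by linarith
    finally show "(1 + y) ^ s \<le> 4" .
  qed (use y in auto)
  finally have "real (card ?F) \<le> 4 ^ t / y ^ t"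
    using y by (simp add: pos_le_divide_eq)
  also have "\<dots> = real ((4 * s) ^ t)"
    by (simp add: y_def power_mult_distrib power_one_over)
  finally show ?thesis by linarith
qed

lemma pigeonhole_fibre:
  assumes "finite W" "finite Y" "f ` W \<subseteq> Y" "c * card Y \<le> card W" "0 < c"
    "W \<noteq> {}"
  shows "\<exists>y\<in>Y. c \<le> card {x\<in>W. f x = y}"
proof (rule ccontr)
  assume "\<not> ?thesis"
  then have lt: "\<And>y. y \<in> Y \<Longrightarrow> card {x\<in>W. f x = y} < c" by force
  have "card W = (\<Sum>y\<in>Y. card {x\<in>W. f x = y})"
    using sum.group[of W Y f "\<lambda>_. 1 :: nat"] assms(1-3) by simp
  \<comment> \<open>As \<open>W\<close> is nonempty, so is \<open>Y\<close>, and the sums compare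
    strictly.\<close>
  also have "\<dots> < (\<Sum>y\<in>Y. c)"
    by (rule sum_strict_mono) (use assms lt in auto)
  finally show False using assms(4) by (simp add: mult.commute)
qed

text \<open>In each round, at least \<open>2 ^ k\<close> vertices share one neighbourhood
  \<open>X\<close> in \<open>A\<close> with at most \<open>t\<close> elements, since there are at
  most \<open>(4 * s) ^ t\<close> candidates for it. A layered \<open>k\<close>-set \<open>T\<close>
  among them has no arcs to \<open>A - X\<close>, so \<open>(A - X) \<union> T\<close> still has
  \<open>k\<close> layers and the gain is at least \<open>k - t\<close>. The upper bound on
  \<open>card A\<close> keeps \<open>rich\<close> applicable.\<close>

lemma layered_accumulation:
  assumes "finite S" "asym R" "1 \<le> s" "b * k \<le> s * t" "t \<le> k"
    and rich: "\<And>A. A \<subseteq> S \<Longrightarrow> card A \<le> b * k \<Longrightarrow>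
      2 ^ k * (4 * s) ^ t \<le> card {v \<in> S - A. card (nbrs R v \<inter> A) \<le> t}"
    and "j \<le> b"
  shows "\<exists>A\<subseteq>S. card A \<le> j * k \<and> j * (k - t) \<le> card A \<and> layered R A k"
  using assms(7)
proof (induction j)
  case 0
  then show ?case by (auto simp: layered_def intro!: exI[of _ "{}"])
next
  case (Suc j)
  then obtain A where A: "A \<subseteq> S" "card A \<le> j * k" "j * (k - t) \<le> card A" "layered R A k"
    by auto
  have finA: "finite A" using A(1) assms(1) finite_subset by blast
  have "j * k \<le> b * k" using Suc.prems by simp
  then have Ab: "card A \<le> b * k" using A(2) by linarith
  define W where "W = {v \<in> S - A. card (nbrs R v \<inter> A) \<le> t}"
  define Y where "Y = {X. X \<subseteq> A \<and> card X \<le> t}"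
  have "card Y \<le> (4 * s) ^ t" unfolding Y_def
    by (rule card_small_subsets) (use finA Ab assms(3,4) in auto)
  then have "2 ^ k * card Y \<le> 2 ^ k * (4 * s) ^ t" by simp
  also have W: "\<dots> \<le> card W" unfolding W_def by (rule rich[OF A(1) Ab])
  finally have le: "2 ^ k * card Y \<le> card W" .
  have "0 < (2::nat) ^ k * (4 * s) ^ t" using assms(3) by simp
  then have "W \<noteq> {}" using W by force
  have "\<exists>X\<in>Y. 2 ^ k \<le> card {v\<in>W. nbrs R v \<inter> A = X}"
  proof (rule pigeonhole_fibre[OF _ _ _ le _ \<open>W \<noteq> {}\<close>])
    show "finite Y" unfolding Y_def using finA by simp
    show "finite W" unfolding W_def using assms(1) by simp
    show "(\<lambda>v. nbrs R v \<inter> A) ` W \<subseteq> Y" unfolding W_def Y_def by auto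
  qed simp
  then obtain X where X: "X \<subseteq> A" "card X \<le> t"
    and big: "2 ^ k \<le> card {v\<in>W. nbrs R v \<inter> A = X}" unfolding Y_def by auto
  have "finite {v\<in>W. nbrs R v \<inter> A = X}" unfolding W_def using assms(1) by simp
  from erdos_moser[OF assms(2) this big] obtain T where
    T: "T \<subseteq> {v\<in>W. nbrs R v \<inter> A = X}" "card T = k" "layered R T k" by auto
  have finT: "finite T" using T(1) assms(1) by (auto simp: W_def intro: finite_subset)
  have disj: "(A - X) \<inter> T = {}" using T(1) by (auto simp: W_def)
  have "layered R ((A - X) \<union> T) k"
  proof (rule layered_Un_no_arcs[OF _ T(3) disj])
    show "layered R (A - X) k" using A(4) layered_mono by blast
  qed (use T(1) in blast)
  moreover have "(A - X) \<union> T \<subseteq> S" using A(1) T(1) by (auto simp: W_def)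
  moreover have "card ((A - X) \<union> T) = card A - card X + k"
    using card_Un_disjoint[OF _ finT disj] finA T(2) card_Diff_subset[of X A] X(1)
    by (metis finite_Diff finite_subset)
  \<comment> \<open>This makes the truncated subtraction \<open>card A - card X\<close> a true
    one.\<close>
  moreover have "card X \<le> card A" using X(1) finA card_mono by blast
  ultimately show ?case using A(2,3) X(2) assms(5)
    by (intro exI[of _ "(A - X) \<union> T"]) auto
qed

section \<open>Degree counting and large layered sets in sparse graphs\<close>

lemma sum_degree_le:
  assumes "finite R" "finite S"
  shows "(\<Sum>v\<in>S. card (nbrs R v)) \<le> 2 * card R"
proof -
  have "(\<Sum>v\<in>S. card (nbrs R v)) = card (SIGMA v:S. nbrs R v)"
    by (subst card_SigmaI) (use assms finite_nbrs in auto)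
  also have "\<dots> \<le> card (R \<union> R\<inverse>)"
    by (rule card_mono) (use assms in \<open>auto simp: nbrs_def\<close>)
  also have "\<dots> \<le> card R + card (R\<inverse>)" by (rule card_Un_le)
  also have "card (R\<inverse>) = card R" by simp
  finally show ?thesis by simp
qed

lemma sum_nbrs_swap:
  assumes "finite S" "finite A"
  shows "(\<Sum>v\<in>S. card (nbrs R v \<inter> A)) = (\<Sum>a\<in>A. card (nbrs R a \<inter> S))"
proof -
  have "(\<Sum>v\<in>S. card (nbrs R v \<inter> A)) = (\<Sum>v\<in>S. \<Sum>a\<in>A. if a \<in> nbrs R v then 1 else 0)"
    using assms by (intro sum.cong) (simp_all add: Int_commute sum.inter_restrict[symmetric] sum.If_cases)
  also have "\<dots> = (\<Sum>a\<in>A. \<Sum>v\<in>S. if v \<in> nbrs R a then 1 else 0)"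
    by (subst sum.swap) (auto simp: nbrs_def intro!: sum.cong)
  also have "\<dots> = (\<Sum>a\<in>A. card (nbrs R a \<inter> S))"
    using assms by (intro sum.cong) (simp_all add: Int_commute sum.inter_restrict[symmetric] sum.If_cases)
  finally show ?thesis .
qed

text \<open>Of at least \<open>M\<close> vertices, at most half are lost for high degree and at most
  a quarter for many neighbours in \<open>A\<close>. By \<open>room\<close>, the remaining quarter
  covers \<open>A\<close> itself and the supply that \<open>layered_accumulation\<close>
  demands.\<close>

lemma large_layered_subset:
  assumes "finite R" "asym R" "finite S" "M \<le> card S" "1 \<le> s" "t \<le> k" "0 < M"
    and m: "8 * s * card R \<le> M * M"
    and bk: "2 * (b * k) \<le> s * t"
    and room: "4 * (2 ^ k * (4 * s) ^ t + b * k) \<le> M"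
  shows "\<exists>A\<subseteq>S. b * (k - t) \<le> card A \<and> layered R A k"
proof -
  let ?m = "card R"
  let ?d = "\<lambda>v. card (nbrs R v)"
  \<comment> \<open>Degree at most \<open>4 * ?m / M\<close>, multiplied out to stay in the natural
    numbers.\<close>
  define S0 where "S0 = {v\<in>S. ?d v * M \<le> 4 * ?m}"
  have finS0: "finite S0" using assms(3) by (simp add: S0_def)
  have high: "2 * card (S - S0) \<le> M"
  proof (cases "?m = 0")
    case True
    then have "R = {}" using assms(1) by simp
    then have "S0 = S" by (auto simp: S0_def nbrs_def)
    then show ?thesis by simp
  next
    case False
    have "card (S - S0) * (4 * ?m) = (\<Sum>v\<in>S - S0. 4 * ?m)" by simp
    also have "\<dots> \<le> (\<Sum>v\<in>S - S0. ?d v * M)"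
      by (rule sum_mono) (auto simp: S0_def)
    also have "\<dots> = (\<Sum>v\<in>S - S0. ?d v) * M" by (simp add: sum_distrib_right)
    also have "\<dots> \<le> 2 * ?m * M"
      using sum_degree_le[OF assms(1), of "S - S0"] assms(3) by (intro mult_right_mono) auto
    finally have "?m * (2 * (2 * card (S - S0))) \<le> ?m * (2 * M)" by (simp add: ac_simps)
    then show ?thesis using False by simp
  qed
  have rich: "2 ^ k * (4 * s) ^ t \<le> card {v \<in> S0 - A. card (nbrs R v \<inter> A) \<le> t}"
    if A: "A \<subseteq> S0" "card A \<le> b * k" for A
  proof -
    have finA: "finite A" using A(1) finS0 finite_subset by blast
    define B where "B = {v\<in>S0. t < card (nbrs R v \<inter> A)}"
    have finB: "finite B" using finS0 by (simp add: B_def)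
    \<comment> \<open>Double counting of adjacent pairs between \<open>B\<close> and
      \<open>A\<close>: a vertex of \<open>B\<close> has more than \<open>t\<close> neighbours in
      \<open>A\<close>, while vertices of \<open>A\<close> have low degree.\<close>
    have "card B * (t + 1) = (\<Sum>v\<in>B. t + 1)" by simp
    also have "\<dots> \<le> (\<Sum>v\<in>B. card (nbrs R v \<inter> A))"
      by (rule sum_mono) (auto simp: B_def)
    also have "\<dots> = (\<Sum>a\<in>A. card (nbrs R a \<inter> B))" by (rule sum_nbrs_swap[OF finB finA])
    also have "\<dots> \<le> (\<Sum>a\<in>A. ?d a)"
      by (rule sum_mono) (auto intro: card_mono finite_nbrs[OF assms(1)])
    finally have "card B * (t + 1) * M \<le> (\<Sum>a\<in>A. ?d a * M)"
      by (simp flip: sum_distrib_right)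
    also have "\<dots> \<le> (\<Sum>a\<in>A. 4 * ?m)"
      by (rule sum_mono) (use A(1) in \<open>auto simp: S0_def\<close>)
    also have "\<dots> = card A * (4 * ?m)" by simp
    also have "\<dots> \<le> b * k * (4 * ?m)" using A(2) by (rule mult_right_mono) simp
    finally have "card B * (t + 1) * M \<le> b * k * (4 * ?m)" .
    then have "4 * (card B * (t + 1) * M) \<le> 4 * (b * k * (4 * ?m))" by (rule mult_left_mono) simp
    also have "\<dots> = 8 * ?m * (2 * (b * k))" by simp
    also have "\<dots> \<le> 8 * ?m * (s * t)" using bk by (rule mult_left_mono) simp
    also have "\<dots> = (8 * s * ?m) * t" by simp
    also have "\<dots> \<le> M * M * t" using m by (rule mult_right_mono) simp
    also have "\<dots> \<le> M * M * (t + 1)" by simp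
    finally have "(t + 1) * M * (4 * card B) \<le> (t + 1) * M * M" by (simp only: ac_simps)
    then have B4: "4 * card B \<le> M" using assms(7) by simp
    have "S \<subseteq> (S - S0) \<union> (A \<union> (B \<union> {v \<in> S0 - A. card (nbrs R v \<inter> A) \<le> t}))"
      using A(1) by (auto simp: B_def)
    then have "card S \<le> card \<dots>"
      by (rule card_mono[rotated]) (use assms(3) finA finB finS0 in auto)
    also have "\<dots> \<le> card (S - S0) + (card A + (card B + card {v \<in> S0 - A. card (nbrs R v \<inter> A) \<le> t}))"
      by (meson add_left_mono card_Un_le order_trans)
    finally have "card S \<le> card (S - S0) + (card A + (card B + card {v \<in> S0 - A. card (nbrs R v \<inter> A) \<le> t}))" .
    moreover have "z \<le> x" if "n \<le> d + (a + (c + x))" "2 * d \<le> M" "4 * c \<le> M" "a \<le> p"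
        "4 * (z + p) \<le> M" "M \<le> n" for n d a c x z p :: nat
    proof -
      have "4 * z + 4 * p \<le> M" using that(5) by simp
      moreover have "4 * d + 4 * c \<le> 3 * M" "4 * n \<le> 4 * d + 4 * a + 4 * c + 4 * x"
        using that by linarith+
      ultimately have "4 * z + 4 * p \<le> M" "4 * M \<le> 3 * M + 4 * a + 4 * x" using that(6) by linarith+
      then have "4 * z + 4 * p \<le> 4 * p + 4 * x" using \<open>4 * z + 4 * p \<le> M\<close> that(4) by linarith
      then show ?thesis by linarith
    qed
    ultimately show ?thesis using high B4 A(2) room assms(4) by blast
  qed
  have "b * k \<le> s * t" using bk by linarith
  from layered_accumulation[OF finS0 assms(2,5) this assms(6) rich order_refl]
  obtain A where "A \<subseteq> S0" "b * (k - t) \<le> card A" "layered R A k" by auto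
  then show ?thesis by (auto simp: S0_def)
qed

section \<open>Parameters and costs of the stages\<close>

lemma double_le_power:
  assumes "1 \<le> (l :: nat)"
  shows "2 * l \<le> 2 ^ l"
  using assms
proof (induction l rule: dec_induct)
  case (step l)
  then show ?case using self_le_power[of 2 l] by simp
qed simp

text \<open>This is \<open>large_layered_subset\<close> with \<open>s = 4 ^ e\<close>. The set found
  has at most \<open>l / 2\<close> layers, hence it costs at most \<open>\<rho>\<close>.\<close>

lemma stage_extraction:
  fixes R :: "('a \<times> 'a) set" and n l \<rho> e :: nat
  assumes "finite R" "asym R" "finite S"
    and n: "2 ^ l \<le> n" and m: "card R \<le> n * n * (l + 1)"
    and \<rho>: "l + 1 \<le> \<rho> * \<rho>" and e: "4 \<le> e" "4 ^ e \<le> l"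
    and S: "2 ^ e * (3 * n * \<rho>) \<le> card S"
  shows "\<exists>A\<subseteq>S. (4 ^ e div (4 * (e + 1))) * ((2 * e + 1) * (l div (4 * (e + 1)))) \<le> card A
           \<and> biorderable R A \<rho>"
proof -
  define t where "t = l div (4 * (e + 1))"
  define b :: nat where "b = 4 ^ e div (4 * (e + 1))"
  \<comment> \<open>Chosen so that \<open>(4 * 4 ^ e) ^ t = 2 ^ k\<close>; the demand for vertices
    then becomes \<open>2 ^ (2 * k)\<close>, which is at most \<open>2 ^ l \<le> n\<close>.\<close>
  define k where "k = (2 * e + 2) * t"
  define M where "M = 2 ^ e * (3 * n * \<rho>)"
  have four: "(4::nat) ^ e = 2 ^ e * 2 ^ e" by (simp flip: power_mult_distrib)
  have npos: "0 < n" using n by (metis less_le_trans zero_less_numeral zero_less_power)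
  have \<rho>pos: "0 < \<rho>" using \<rho> by (cases \<rho>) auto
  have tl: "4 * (e + 1) * t \<le> l" unfolding t_def by (rule times_div_less_eq_dividend)
  have be: "4 * (e + 1) * b \<le> 4 ^ e" unfolding b_def by (rule times_div_less_eq_dividend)
  have bk: "2 * (b * k) \<le> 4 ^ e * t"
  proof -
    have "2 * (b * k) = (4 * (e + 1) * b) * t" by (simp add: k_def algebra_simps)
    also have "\<dots> \<le> 4 ^ e * t" using be by (rule mult_right_mono) simp
    finally show ?thesis .
  qed
  have e\<rho>: "2 ^ e \<le> \<rho>"
  proof (rule ccontr)
    assume "\<not> 2 ^ e \<le> \<rho>"
    then have "\<rho> * \<rho> \<le> 2 ^ e * 2 ^ e" by (intro mult_mono) auto
    then show False using e(2) \<rho> four by linarith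
  qed
  have tn: "t \<le> n"
  proof -
    have "t \<le> l" unfolding t_def by simp
    also have "l \<le> 2 ^ l" by (simp add: less_imp_le)
    finally show ?thesis using n by linarith
  qed
  have "4 * (2 ^ k * (4 * 4 ^ e) ^ t + b * k) \<le> M"
  proof -
    have "(2::nat) ^ k * (4 * 4 ^ e) ^ t = 2 ^ (2 * k)"
    proof -
      have "(4::nat) * 4 ^ e = 2 ^ (2 * e + 2)" by (simp add: power_add power_mult)
      then have "((4::nat) * 4 ^ e) ^ t = 2 ^ k" by (simp only: k_def power_mult)
      then show ?thesis by (simp add: mult_2 power_add)
    qed
    also have "\<dots> \<le> 2 ^ l" using tl by (intro power_increasing) (auto simp: k_def algebra_simps)
    also have "\<dots> \<le> n" by (rule n)
    finally have 1: "(2::nat) ^ k * (4 * 4 ^ e) ^ t \<le> n" .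
    have "(2::nat) ^ 2 \<le> 2 ^ e" using e(1) by (intro power_increasing) auto
    then have "4 * 1 \<le> 2 ^ e * \<rho>" using \<rho>pos by (intro mult_mono) auto
    then have "4 * 1 * n \<le> 2 ^ e * \<rho> * n" by (rule mult_right_mono) simp
    then have 2: "4 * n \<le> 2 ^ e * (n * \<rho>)" by (simp add: ac_simps)
    have "4 ^ e * t = 2 ^ e * (2 ^ e * t)" by (simp add: four)
    also have "\<dots> \<le> 2 ^ e * (\<rho> * n)" using e\<rho> tn by (intro mult_left_mono mult_mono) auto
    finally have 3: "4 * (b * k) \<le> 2 * (2 ^ e * (n * \<rho>))" using bk by (simp add: ac_simps)
    have "M = 3 * (2 ^ e * (n * \<rho>))" by (simp add: M_def)
    moreover have "4 * (2 ^ k * (4 * 4 ^ e) ^ t) \<le> 4 * n" using 1 by (rule mult_left_mono) simp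
    ultimately show ?thesis using 2 3 unfolding distrib_left by linarith
  qed
  \<comment> \<open>The factor 3 in \<open>M\<close> is used here: its square 9 dominates the
    required 8.\<close>
  moreover have "8 * 4 ^ e * card R \<le> M * M"
  proof -
    have "8 * 4 ^ e * card R \<le> 8 * 4 ^ e * (n * n * (\<rho> * \<rho>))"
      using m \<rho> by (meson le_trans mult_left_mono zero_le)
    also have "\<dots> \<le> 9 * 4 ^ e * (n * n * (\<rho> * \<rho>))" by (intro mult_right_mono) auto
    also have "\<dots> = M * M" by (simp add: M_def four)
    finally show ?thesis .
  qed
  moreover have "0 < M" using npos \<rho>pos by (simp add: M_def)
  ultimately obtain A where A: "A \<subseteq> S" "b * (k - t) \<le> card A" "layered R A k"
    using large_layered_subset[OF assms(1-3) S[folded M_def], of "4 ^ e" t k b] bk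
    by (auto simp: k_def)
  have "k - t = (2 * e + 1) * t" by (simp add: k_def algebra_simps)
  moreover have "k \<le> \<rho> * \<rho>" using tl \<rho> by (simp add: k_def algebra_simps)
  ultimately show ?thesis
    using A layered_imp_biorderable unfolding b_def t_def by metis
qed

text \<open>Rounding down loses at most a fifth of the first quotient, as
  \<open>20 * (e + 1) \<le> 4 ^ e\<close>, and at most a tenth of the second, as
  \<open>40 * (e + 1) \<le> l\<close>. Moreover \<open>2 * e + 1\<close> is at least 9/5 of
  \<open>e + 1\<close>. The product of 1/5, 9/5 and 9/40 is 81/1000.\<close>

lemma stage_size_bound:
  fixes l e :: nat
  assumes e: "4 \<le> e" "4 ^ e \<le> l" and l: "3500 \<le> l"
  shows "81 * (4 ^ e * real l) \<le> 1000 * real (e + 1) *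
    real ((4 ^ e div (4 * (e + 1))) * ((2 * e + 1) * (l div (4 * (e + 1)))))"
proof -
  define x where "x = real (e + 1)"
  have x: "5 \<le> x" using e(1) by (simp add: x_def)
  have e4: "40 * (e + 1) \<le> 4 ^ e \<or> e = 4"
  proof (cases "e = 4")
    case False
    then have "5 \<le> e" using e(1) by simp
    then have "40 * (e + 1) \<le> 4 ^ e"
      by (induction e rule: dec_induct) auto
    then show ?thesis by simp
  qed simp
  then have l40: "40 * (e + 1) \<le> l" using e(2) l by auto
  have e20: "20 * (e + 1) \<le> 4 ^ e" using e4 by auto
  have floor: "real a / real c - 1 \<le> real (a div c)" if "0 < c" for a c :: nat
    using floor_divide_of_nat_eq[of a c, where 'a = real] by linarith
  have b: "4 ^ e / (5 * x) \<le> real (4 ^ e div (4 * (e + 1)))"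
  proof -
    have "20 * x \<le> 4 ^ e" using e20 unfolding x_def
      by (metis of_nat_le_iff of_nat_mult of_nat_numeral of_nat_power)
    then have "4 ^ e / (5 * x) \<le> 4 ^ e / (4 * x) - 1" using x by (simp add: field_simps)
    also have "\<dots> \<le> real (4 ^ e div (4 * (e + 1)))"
      using floor[of "4 * (e + 1)" "4 ^ e"] by (simp add: x_def)
    finally show ?thesis .
  qed
  have t: "9 * real l / (40 * x) \<le> real (l div (4 * (e + 1)))"
  proof -
    have "40 * x \<le> real l" using l40 unfolding x_def
      by (metis of_nat_le_iff of_nat_mult of_nat_numeral)
    then have "9 * real l / (40 * x) \<le> real l / (4 * x) - 1" using x by (simp add: field_simps)
    also have "\<dots> \<le> real (l div (4 * (e + 1)))"
      using floor[of "4 * (e + 1)" l] by (simp add: x_def)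
    finally show ?thesis .
  qed
  have "81 * (4 ^ e * real l) = 1000 * x * (4 ^ e / (5 * x) * (9 / 5 * x * (9 * real l / (40 * x))))"
    using x by (simp add: field_simps)
  also have "\<dots> \<le> 1000 * x * (real (4 ^ e div (4 * (e + 1))) *
      (real (2 * e + 1) * real (l div (4 * (e + 1)))))"
    using x e(1) b t by (intro mult_left_mono mult_mono) (auto simp: x_def)
  finally show ?thesis by (simp only: x_def of_nat_mult)
qed

text \<open>The cost is \<open>\<rho>\<close> per round. In units of
  \<open>(e + 1) * n / 2 ^ e\<close>, the quotient accounts for at most 3 * 21/20 * 1000/81 < 39,
  and the extra round for at most 1.\<close>

lemma stage_cost_bound:
  fixes n l \<rho> e :: nat
  assumes e: "4 \<le> e" "4 ^ e \<le> l" and l: "3500 \<le> l"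
    and n: "2 ^ l \<le> n" and \<rho>: "l + 1 \<le> \<rho> * \<rho>" "20 * (\<rho> * \<rho>) \<le> 21 * l"
    and q: "q = (4 ^ e div (4 * (e + 1))) * ((2 * e + 1) * (l div (4 * (e + 1))))"
  shows "0 < q" "real (\<rho> * (2 ^ e * (3 * n * \<rho>) div q + 1)) \<le> 40 * real (e + 1) / 2 ^ e * real n"
proof -
  define x where "x = (2::real) ^ e"
  define y where "y = real (e + 1)"
  have x: "0 < x" "4 ^ e = x * x" by (auto simp: x_def simp flip: power_mult_distrib)
  have y: "1 \<le> y" by (simp add: y_def)
  have lpos: "0 < real l" using l by simp
  have size: "81 * (x * x * real l) \<le> 1000 * y * real q"
    using stage_size_bound[OF e l] unfolding q x y_def .
  have "0 < 81 * (x * x * real l)" using x lpos by simp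
  then have "0 < 1000 * y * real q" using size by linarith
  then show qpos: "0 < q" using y by (simp add: zero_less_mult_iff)
  have \<rho>': "real \<rho> * real \<rho> \<le> 21 / 20 * real l"
    using of_nat_mono[OF \<rho>(2), where 'a = real] by simp
  have main: "real \<rho> * (x * (3 * real n * real \<rho>) / real q) \<le> 39 * y / x * real n"
  proof -
    have "real \<rho> * (x * (3 * real n * real \<rho>)) * x = 3 * real n * x * x * (real \<rho> * real \<rho>)"
      by simp
    also have "\<dots> \<le> 3 * real n * x * x * (21 / 20 * real l)"
      using \<rho>' x by (intro mult_left_mono) auto
    also have "\<dots> = 63 / 20 / 81 * real n * (81 * (x * x * real l))" by simp
    also have "\<dots> \<le> 63 / 20 / 81 * real n * (1000 * y * real q)"
      using size by (intro mult_left_mono) auto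
    also have "\<dots> = 350 / 9 * (y * real n * real q)" by simp
    also have "\<dots> \<le> 39 * (y * real n * real q)" using y by (intro mult_right_mono) auto
    finally have "real \<rho> * (x * (3 * real n * real \<rho>)) * x \<le> 39 * y * real n * real q"
      by (simp only: mult.assoc)
    then have "real \<rho> * (x * (3 * real n * real \<rho>)) / real q \<le> 39 * y * real n / x"
      using x qpos by (simp add: pos_divide_le_eq pos_le_divide_eq mult.commute)
    then show ?thesis by simp
  qed
  have small: "real \<rho> \<le> y / x * real n"
  proof -
    have "2 ^ e \<le> \<rho>"
    proof (rule ccontr)
      assume "\<not> 2 ^ e \<le> \<rho>"
      then have "\<rho> * \<rho> \<le> 2 ^ e * 2 ^ e" by (intro mult_mono) auto
      also have "\<dots> = 4 ^ e" by (simp flip: power_mult_distrib)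
      finally show False using e(2) \<rho>(1) by linarith
    qed
    then have "\<rho> * 2 ^ e \<le> \<rho> * \<rho>" by simp
    also have "\<dots> \<le> 2 * l" using \<rho>(2) by linarith
    also have "2 * l \<le> 2 ^ l" using l by (intro double_le_power) simp
    also have "\<dots> \<le> n" by (rule n)
    finally have "real (\<rho> * 2 ^ e) \<le> real n" by (rule of_nat_mono)
    then have "real \<rho> * x \<le> real n" by (simp add: x_def)
    also have "\<dots> \<le> y * real n" using mult_right_mono[OF y, of "real n"] by simp
    finally show ?thesis using x(1) by (simp add: pos_le_divide_eq)
  qed
  have "real (\<rho> * (2 ^ e * (3 * n * \<rho>) div q + 1))
      = real \<rho> * real (2 ^ e * (3 * n * \<rho>) div q) + real \<rho>" by (simp add: algebra_simps)
  also have "\<dots> \<le> real \<rho> * (x * (3 * real n * real \<rho>) / real q) + real \<rho>"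
    using of_nat_div_le_of_nat[of "2 ^ e * (3 * n * \<rho>)" q, where 'a = real]
    by (intro add_right_mono mult_left_mono) (auto simp: x_def)
  also have "\<dots> \<le> 39 * y / x * real n + y / x * real n" using main small by (rule add_mono)
  also have "\<dots> = 40 * y / x * real n" by (simp flip: distrib_right add_divide_distrib)
  finally show "real (\<rho> * (2 ^ e * (3 * n * \<rho>) div q + 1)) \<le> 40 * real (e + 1) / 2 ^ e * real n"
    by (simp add: x_def y_def)
qed

text \<open>
  \<open>40 (i + 1) / 2^i\<close> is the cost of stage \<open>i\<close>, and \<open>80 (e + 2) / 2^e\<close> is the tail of the sum of these
  over \<open>i \<ge> e\<close>.
\<close>

lemma biorderable_stages:
  fixes R :: "('a \<times> 'a) set" and n l \<rho> e :: nat
  assumes R: "finite R" "asym R" and l: "3500 \<le> l"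
    and n: "2 ^ l \<le> n" and m: "card R \<le> n * n * (l + 1)"
    and \<rho>: "l + 1 \<le> \<rho> * \<rho>" "20 * (\<rho> * \<rho>) \<le> 21 * l"
    and e: "4 \<le> e" "4 ^ e \<le> 4 * l"
    and S: "finite S" "card S \<le> 2 ^ e * (3 * n * \<rho>)"
  shows "\<exists>K. biorderable R S K \<and> real K \<le> (100 - 80 * real (e + 2) / 2 ^ e) * real n"
  using e S
proof (induction e arbitrary: S rule: nat_induct_at_least)
  \<comment> \<open>For \<open>e = 4\<close> there are at most \<open>48 * n * \<rho>\<close>
    vertices: acyclic sets of size \<open>l\<close> are removed while at least \<open>n\<close>
    vertices remain, and the last \<open>n\<close> are placed one at a time.\<close>
  case base
  have large: "\<exists>A\<subseteq>S'. l \<le> card A \<and> biorderable R A \<rho>" if S': "S' \<subseteq> S" "n \<le> card S'" for S'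
  proof -
    have "finite S'" using S'(1) base(2) by (rule finite_subset)
    moreover have "2 ^ l \<le> card S'" using n S'(2) by (rule le_trans)
    ultimately
    obtain A where "A \<subseteq> S'" "card A = l" "layered R A l" using erdos_moser[OF R(2)] by blast
    moreover have "l \<le> \<rho> * \<rho>" using \<rho>(1) by linarith
    ultimately show ?thesis using layered_imp_biorderable by blast
  qed
  have small: "biorderable R S' n" if S': "S' \<subseteq> S" "card S' \<le> n" for S'
  proof -
    have "finite S'" using S'(1) base(2) by (rule finite_subset)
    from biorderable_mono[OF biorderable_card[OF this R(2)] order_refl S'(2)] show ?thesis .
  qed
  define j where "j = 48 * n * \<rho> div l + 1"
  have "48 * n * \<rho> \<le> l * j" using dividend_less_times_div[of l "48 * n * \<rho>"] l
    by (simp add: j_def)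
  then have "card S \<le> n + l * j" using base by simp
  from biorderable_extraction[OF base(2) large small order_refl this]
  have "biorderable R S (n + \<rho> * j)" .
  \<comment> \<open>70 is the claimed bound at \<open>e = 4\<close>, namely 100 - 80 * 6/16. The
    actual cost is at most \<open>n + 51 * n + \<rho>\<close>, where 51 is 48 * 21/20 rounded
    up.\<close>
  moreover have "real (n + \<rho> * j) \<le> 70 * real n"
  proof -
    have "\<rho> * j \<le> \<rho> * (48 * n * \<rho> div l) + \<rho>" by (simp add: j_def)
    moreover have "real (\<rho> * (48 * n * \<rho> div l)) \<le> 51 * real n"
    proof -
      have "real (\<rho> * (48 * n * \<rho> div l)) \<le> real \<rho> * (real (48 * n * \<rho>) / real l)"
        using of_nat_div_le_of_nat[of "48 * n * \<rho>" l, where 'a = real]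
        unfolding of_nat_mult by (intro mult_left_mono) simp_all
      also have "\<dots> = 48 * real n * (real (\<rho> * \<rho>) / real l)" by simp
      also have "\<dots> \<le> 48 * real n * (21 / 20)"
      proof (rule mult_left_mono)
        have "20 * real (\<rho> * \<rho>) \<le> 21 * real l"
          using of_nat_mono[OF \<rho>(2), where 'a = real] by simp
        then show "real (\<rho> * \<rho>) / real l \<le> 21 / 20" using l by (simp add: field_simps)
      qed simp
      finally show ?thesis by simp
    qed
    moreover have "\<rho> \<le> n"
    proof -
      have "\<rho> \<le> \<rho> * \<rho>" by (cases \<rho>) auto
      also have "\<dots> \<le> 2 * l" using \<rho>(2) by linarith
      also have "2 * l \<le> 2 ^ l" using l by (intro double_le_power) simp
      finally show ?thesis using n by linarith
    qed
    ultimately show ?thesis by linarith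
  qed
  ultimately show ?case by (intro exI[of _ "n + \<rho> * j"]) simp
next
  case (Suc e)
  define B where "B = (100 - 80 * real (e + 2) / 2 ^ e) * real n"
  define M where "M = 2 ^ e * (3 * n * \<rho>)"
  define q where "q = (4 ^ e div (4 * (e + 1))) * ((2 * e + 1) * (l div (4 * (e + 1))))"
  define j where "j = M div q + 1"
  have el: "4 ^ e \<le> l" using Suc.prems(1) by simp
  then have el': "4 ^ e \<le> 4 * l" by simp
  have IH: "\<exists>K. biorderable R S' K \<and> real K \<le> B" if "finite S'" "card S' \<le> M" for S'
    using Suc.IH[OF el'] that unfolding B_def M_def by blast
  \<comment> \<open>The induction hypothesis for the empty set shows that \<open>B\<close> is
    nonnegative, so its floor is one natural bound valid for all small subsets at once.\<close>
  have B: "0 \<le> B" using IH[of "{}"] by fastforce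
  have small: "biorderable R S' (nat \<lfloor>B\<rfloor>)" if S': "S' \<subseteq> S" "card S' \<le> M" for S'
  proof -
    have "finite S'" using S'(1) Suc.prems(2) finite_subset by blast
    then obtain K where "biorderable R S' K" "real K \<le> B" using IH S'(2) by blast
    then show ?thesis using biorderable_mono le_nat_floor by blast
  qed
  have large: "\<exists>A\<subseteq>S'. q \<le> card A \<and> biorderable R A \<rho>" if S': "S' \<subseteq> S" "M \<le> card S'" for S'
  proof -
    have "finite S'" using S'(1) Suc.prems(2) finite_subset by blast
    from stage_extraction[OF R this n m \<rho>(1) Suc.hyps el] S'(2)
    show ?thesis unfolding M_def q_def by blast
  qed
  note cost = stage_cost_bound[OF Suc.hyps el l n \<rho> q_def]
  have "M \<le> q * j" using dividend_less_times_div[OF cost(1), of M] by (simp add: j_def)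
  then have "card S \<le> M + q * j" using Suc.prems(3) by (simp add: M_def)
  from biorderable_extraction[OF Suc.prems(2) large small order_refl this]
  have "biorderable R S (nat \<lfloor>B\<rfloor> + \<rho> * j)" .
  moreover have "real (nat \<lfloor>B\<rfloor> + \<rho> * j) \<le> (100 - 80 * real (Suc e + 2) / 2 ^ Suc e) * real n"
  proof -
    have "real (\<rho> * j) \<le> 40 * real (e + 1) / 2 ^ e * real n"
      using cost(2) unfolding j_def M_def .
    moreover have "real (nat \<lfloor>B\<rfloor>) \<le> B" by (rule of_nat_floor[OF B])
    \<comment> \<open>The bound telescopes:
      \<open>80 * (e + 2) / 2 ^ e - 80 * (e + 3) / 2 ^ (e + 1)\<close> equals
      \<open>40 * (e + 1) / 2 ^ e\<close>.\<close>
    moreover have "B + 40 * real (e + 1) / 2 ^ e * real n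
        = (100 - 80 * real (Suc e + 2) / 2 ^ Suc e) * real n"
      by (simp add: B_def field_simps)
    ultimately show ?thesis by simp
  qed
  ultimately show ?case by blast
qed

section \<open>Splitting by degree and the bound for sparse graphs\<close>

lemma card_high_degree:
  assumes "finite R" "finite V"
  shows "card {v \<in> V. d \<le> card (nbrs R v)} * d \<le> 2 * card R"
proof -
  let ?H = "{v \<in> V. d \<le> card (nbrs R v)}"
  have "card ?H * d = (\<Sum>v\<in>?H. d)" by simp
  also have "\<dots> \<le> (\<Sum>v\<in>?H. card (nbrs R v))" by (rule sum_mono) simp
  also have "\<dots> \<le> 2 * card R" by (rule sum_degree_le) (use assms in auto)
  finally show ?thesis .
qed

lemma biorderable_split_degree:
  assumes "finite R" "asym R" "finite V"
    and "biorderable R {v \<in> V. d \<le> card (nbrs R v)} K"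
  shows "biorderable R V (d + K)"
proof -
  have "biorderable R {v \<in> V. card (nbrs R v) < d} d"
    by (rule biorderable_low_degree) (use assms in auto)
  from biorderable_Un[OF this assms(4)] show ?thesis
    by (rule biorderable_mono) auto
qed

text \<open>For the least \<open>r\<close> with the first property, \<open>d = r - 1\<close>
  satisfies \<open>d * d \<le> l\<close>. Passing from \<open>d\<close> to \<open>r\<close> adds
  \<open>2 * d + 1\<close> to the square, at most a twentieth of \<open>d * d\<close> once
  \<open>d \<ge> 59\<close>.\<close>

lemma ex_sqrt_above:
  fixes l :: nat
  assumes "3500 \<le> l"
  shows "\<exists>r. l + 1 \<le> r * r \<and> 20 * (r * r) \<le> 21 * l"
proof -
  define r where "r = (LEAST r. l + 1 \<le> r * r)"
  have r: "l + 1 \<le> r * r" unfolding r_def by (rule LeastI[of _ "l + 1"]) simp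
  obtain d where d: "r = Suc d" using r by (cases r) auto
  have "\<not> l + 1 \<le> d * d" using not_less_Least[of d "\<lambda>r. l + 1 \<le> r * r"] d r_def by simp
  then have dl: "d * d \<le> l" by simp
  have "59 \<le> d"
  proof (rule ccontr)
    assume "\<not> 59 \<le> d"
    then have "r * r \<le> 59 * 59" using d by (intro mult_mono) auto
    then show False using r assms by simp
  qed
  then have "59 * d \<le> d * d" by simp
  then have "40 * d + 20 \<le> d * d" using \<open>59 \<le> d\<close> by linarith
  moreover have "r * r = d * d + 2 * d + 1" using d by simp
  ultimately have "20 * (r * r) \<le> 21 * l" using dl by linarith
  then show ?thesis using r by blast
qed

text \<open>For \<open>l < 3500\<close> splitting by degree is enough; from 3500 on the stages give
  a total of at most \<open>101 * n\<close>. The constant 169 thus comes from the first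
  case.\<close>

lemma biorderable_sparse:
  fixes R :: "('a \<times> 'a) set" and n :: nat
  assumes "finite R" "asym R" "finite V" "1 \<le> n"
    and m: "real (card R) \<le> real n ^ 2 * log 2 (real n)"
  shows "biorderable R V (169 * n)"
proof -
  obtain l where l: "2 ^ l \<le> n" "n < 2 ^ (l + 1)"
    using ex_power_ivl1[of 2 n] assms(4) by auto
  have "log 2 (real n) \<le> real (l + 1)"
  proof -
    have "real n \<le> 2 ^ (l + 1)"
      using l(2) by (metis less_imp_le of_nat_le_iff of_nat_numeral of_nat_power)
    also have "\<dots> = 2 powr real (l + 1)" by (rule powr_realpow[symmetric]) simp
    finally show ?thesis using assms(4) by (simp add: log_le_iff)
  qed
  then have "real (card R) \<le> real n ^ 2 * real (l + 1)"
    using m by (meson mult_left_mono order_trans zero_le_power2)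
  then have "real (card R) \<le> real (n * n * (l + 1))" by (simp only: power2_eq_square of_nat_mult)
  then have R: "card R \<le> n * n * (l + 1)" by linarith
  show ?thesis
  proof (cases "3500 \<le> l")
    case False
    \<comment> \<open>At most \<open>7000 * n / 84 < 85 * n\<close> vertices have such a degree, and
      84 + 85 = 169. The threshold 84 is near the square root of 7000, which balances the two
      costs.\<close>
    let ?H = "{v \<in> V. 84 * n \<le> card (nbrs R v)}"
    have "card ?H * (84 * n) \<le> 2 * (n * n * (l + 1))"
      using card_high_degree[OF assms(1,3)] R by (meson le_trans mult_le_mono2)
    also have "\<dots> \<le> 2 * (n * n * 3500)" using False by (intro mult_left_mono) auto
    finally have "n * (card ?H * 84) \<le> n * (7000 * n)" by (simp add: ac_simps)
    then have "card ?H \<le> 85 * n" using assms(4) by simp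
    moreover have "biorderable R ?H (card ?H)"
      by (rule biorderable_card) (use assms in auto)
    ultimately have "biorderable R ?H (85 * n)" using biorderable_mono by blast
    from biorderable_split_degree[OF assms(1-3) this] show ?thesis by simp
  next
    case True
    let ?H = "{v \<in> V. n \<le> card (nbrs R v)}"
    obtain \<rho> where \<rho>: "l + 1 \<le> \<rho> * \<rho>" "20 * (\<rho> * \<rho>) \<le> 21 * l"
      using ex_sqrt_above[OF True] by blast
    \<comment> \<open>Stage \<open>E + 1\<close> is the topmost one: \<open>2 ^ (E + 1)\<close>
      exceeds the square root of \<open>l\<close>, so
      \<open>l + 1 \<le> 2 ^ (E + 1) * \<rho>\<close> and all high-degree vertices fit into
      it.\<close>
    obtain E where E: "4 ^ E \<le> l" "l < 4 ^ (E + 1)"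
      using ex_power_ivl1[of 4 l] True by auto
    have "3 < E"
    proof (rule ccontr)
      assume "\<not> 3 < E"
      then have "(4::nat) ^ (E + 1) \<le> 4 ^ 4" by (intro power_increasing) auto
      then show False using E(2) True by simp
    qed
    have "card ?H \<le> 2 ^ (E + 1) * (3 * n * \<rho>)"
    proof -
      have "card ?H * n \<le> 2 * (n * n * (l + 1))"
        using card_high_degree[OF assms(1,3)] R by (meson le_trans mult_le_mono2)
      then have "n * card ?H \<le> n * (2 * n * (l + 1))" by (simp add: ac_simps)
      then have 1: "card ?H \<le> 2 * n * (l + 1)" using assms(4) by simp
      have "l + 1 \<le> 2 ^ (E + 1) * \<rho>"
      proof (rule ccontr)
        assume "\<not> ?thesis"
        then have "(2 ^ (E + 1) * \<rho>) * (2 ^ (E + 1) * \<rho>) < (l + 1) * (l + 1)"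
          by (intro mult_strict_mono) auto
        also have "(2 ^ (E + 1) * \<rho>) * (2 ^ (E + 1) * \<rho>) = 4 ^ (E + 1) * (\<rho> * \<rho>)"
          by (simp flip: power_mult_distrib)
        finally have "4 ^ (E + 1) * (\<rho> * \<rho>) < (l + 1) * (l + 1)" .
        moreover have "(l + 1) * (l + 1) \<le> 4 ^ (E + 1) * (\<rho> * \<rho>)"
          using E(2) \<rho>(1) by (intro mult_mono) auto
        ultimately show False by linarith
      qed
      then have "2 * n * (l + 1) \<le> 3 * n * (2 ^ (E + 1) * \<rho>)" by (intro mult_mono) auto
      then show ?thesis using 1 by (simp add: ac_simps)
    qed
    moreover have "4 \<le> E + 1" "4 ^ (E + 1) \<le> 4 * l" using \<open>3 < E\<close> E(1) by auto
    ultimately obtain K where K: "biorderable R ?H K"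
        "real K \<le> (100 - 80 * real (E + 1 + 2) / 2 ^ (E + 1)) * real n"
      using biorderable_stages[OF assms(1,2) True l(1) R \<rho>, of "E + 1" ?H] assms(3) by auto
    have "(100 - 80 * real (E + 1 + 2) / 2 ^ (E + 1)) * real n \<le> 100 * real n"
      by (intro mult_right_mono) auto
    then have "K \<le> 100 * n" using K(2) by linarith
    then have "n + K \<le> 169 * n" by simp
    with biorderable_split_degree[OF assms(1-3) K(1)] show ?thesis
      using biorderable_mono by blast
  qed
qed

section \<open>From vertex orders to arc colourings\<close>

text \<open>Colour 1 marks the arcs that raise \<open>f\<close>; all others raise \<open>g\<close>.
  Along a monochromatic path one of the two functions grows by at least one per arc while it stays
  below \<open>K\<close>.\<close>

lemma biorderable_colouring:
  assumes "wf_digraph G" "biorderable (arcs_ends G) (verts G) K"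
  shows "\<exists>c. two_colouring G c \<and>
    (\<forall>u p v. pre_digraph.apath G u p v \<and> monochromatic c p \<longrightarrow> length p \<le> K)"
proof -
  interpret wf_digraph G by (rule assms(1))
  obtain f g where fg: "\<And>v. v \<in> verts G \<Longrightarrow> f v < K \<and> g v < K"
      "\<And>u v. u \<in> verts G \<Longrightarrow> v \<in> verts G \<Longrightarrow> (u, v) \<in> arcs_ends G \<Longrightarrow> f u < f v \<or> g u < g v"
    using assms(2) unfolding biorderable_def by metis
  define c :: "'b \<Rightarrow> nat" where "c e = (if f (tail G e) < f (head G e) then 1 else 2)" for e
  have arc: "g (tail G e) < g (head G e)" if "e \<in> arcs G" "c e \<noteq> 1" for e
    using that fg(2)[of "tail G e" "head G e"] by (auto simp: c_def arcs_ends_conv split: if_splits)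
  have climb: "h u + length p \<le> h v"
    if "cas u p v" "set p \<subseteq> arcs G" "\<And>e. e \<in> set p \<Longrightarrow> h (tail G e) < h (head G e)"
    for h :: "'a \<Rightarrow> nat" and u p v
    using that
  proof (induction p arbitrary: u)
    case (Cons e p)
    have "h (head G e) + length p \<le> h v" using Cons by auto
    moreover have "h u < h (head G e)" using Cons.prems by auto
    ultimately show ?case by simp
  qed simp
  have "length p \<le> K" if p: "apath u p v" and mono: "monochromatic c p" for u p v
  proof -
    have w: "cas u p v" "set p \<subseteq> arcs G" "v \<in> verts G"
      using p awalk_last_in_verts unfolding apath_def awalk_def by auto
    obtain i where "\<forall>e\<in>set p. c e = i"
      using mono[unfolded monochromatic_def] by (elim exE)
    then have i: "c e = i" if "e \<in> set p" for e using that by (rule bspec)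
    show ?thesis
    proof (cases "i = 1")
      case True
      have "f (tail G e) < f (head G e)" if "e \<in> set p" for e
        using i[OF that] unfolding True c_def by (cases "f (tail G e) < f (head G e)") simp_all
      from climb[OF w(1,2) this] fg(1)[OF w(3)] show ?thesis by simp
    next
      case False
      have "g (tail G e) < g (head G e)" if "e \<in> set p" for e
      proof (rule arc)
        show "e \<in> arcs G" using that w(2) by (rule rev_subsetD)
        show "c e \<noteq> 1" using i[OF that] False by simp
      qed
      from climb[OF w(1,2) this] fg(1)[OF w(3)] show ?thesis by simp
    qed
  qed
  moreover have "two_colouring G c" by (simp add: two_colouring_def c_def)
  ultimately show ?thesis by blast
qed

theorem theorem1:
  fixes G :: "('a, 'b) pre_digraph" and n :: nat
  assumes "n \<ge> 1"
    and "oriented_graph G"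
    and "real (card (arcs G)) \<le> real n ^ 2 * log 2 (real n)"
  shows "\<exists>c. two_colouring G c \<and>
           (\<forall>u p v. pre_digraph.apath G u p v \<and> monochromatic c p \<longrightarrow> length p \<le> 169 * n)"
proof -
  interpret oriented_graph G by (rule assms(2))
  have "finite (arcs_ends G)" by (simp add: arcs_ends_def)
  moreover have "asym (arcs_ends G)" using no_opposite_arcs by (rule asymI)
  moreover have "card (arcs_ends G) \<le> card (arcs G)"
    unfolding arcs_ends_def by (rule card_image_le) simp
  then have "real (card (arcs_ends G)) \<le> real n ^ 2 * log 2 (real n)"
    using assms(3) by linarith
  ultimately have "biorderable (arcs_ends G) (verts G) (169 * n)"
    using biorderable_sparse assms(1) finite_verts by blast
  then show ?thesis by (rule biorderable_colouring[OF wf_digraph])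
qed

end
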